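(* For every definitive set $X \in \mathcal{D}$ and every linear-time temporal property $P \subseteq \Sigma^\omega$: $$\mathrm{Pr}(X) = P \quad\text{if and only if}\quad X = \mathrm{Df}(P).$$
   Context: Fix a set $A$ of atomic propositions and let $\Sigma = \mathcal{P}(A)$ be the set of states. $\Sigma^*$ is the set of finite traces (finite sequences of states, including the empty trace $\varepsilon$), $\Sigma^\omega$ the set of infinite traces, and $\Sigma^\infty = \Sigma^* \cup \Sigma^\omega$. Traces $t,u$ are concatenated as $tu$, with $tu = t$ if $t$ is infinite. For $X \subseteq \Sigma^\infty$, $\downarrow X = \{u \mid \exists t \in X.\ \exists v \in \Sigma^\infty.\ t = uv\}$ is the set of prefixes of traces in $X$; for a trace $t$, $\uparrow t = \{tu \mid u \in \Sigma^\infty\}$ is its set of extensions. The set of definitive prefixes of $X\subseteq\Sigma^\infty$ is $\mathrm{dp}(X) = \{t \in \Sigma^\infty \mid \uparrow t \subseteq \downarrow X\}$. A set $X \subseteq \Sigma^\infty$ is definitive iff $X = \mathrm{dp}(X)$; $\mathcal{D}$ denotes the set of all definitive sets. A linear-time temporal property is a subset of $\Sigma^\omega$. The maps $\mathrm{Pr} : \mathcal{D} \to \mathcal{P}(\Sigma^\omega)$ and $\mathrm{Df} : \mathcal{P}(\Sigma^\omega) \to \mathcal{D}$ are defined by $\mathrm{Pr}(X) = X \cap \Sigma^\omega$ and $\mathrm{Df}(P) = \mathrm{dp}(P)$ (the set $\mathrm{dp}(P)$ is always definitive). *)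

theory Defs
  imports "HOL-Library.Stream"
begin

text \<open>
  The set \<open>A\<close> of atomic propositions is an explicit set parameter rather than a type, so that it
  may be an arbitrary (possibly empty) set. Every notion below is relative to it.
\<close>

definition states :: "'a set \<Rightarrow> 'a set set" where
  "states A = Pow A"

datatype 's trace = FinTr "'s list" | InfTr "'s stream"

definition fin_traces :: "'a set \<Rightarrow> 'a set trace set" where
  "fin_traces A = FinTr ` lists (states A)"

definition inf_traces :: "'a set \<Rightarrow> 'a set trace set" where
  "inf_traces A = InfTr ` streams (states A)"

definition traces :: "'a set \<Rightarrow> 'a set trace set" where
  "traces A = fin_traces A \<union> inf_traces A"

fun conc :: "'s trace \<Rightarrow> 's trace \<Rightarrow> 's trace" (infixr "\<cdot>" 65) where
  "FinTr xs \<cdot> FinTr ys = FinTr (xs @ ys)"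
| "FinTr xs \<cdot> InfTr s = InfTr (xs @- s)"
| "InfTr s \<cdot> u = InfTr s"

definition prefixes_of :: "'a set \<Rightarrow> 'a set trace set \<Rightarrow> 'a set trace set" where
  "prefixes_of A X = {u \<in> traces A. \<exists>t\<in>X. \<exists>v\<in>traces A. t = u \<cdot> v}"

definition extensions :: "'a set \<Rightarrow> 'a set trace \<Rightarrow> 'a set trace set" where
  "extensions A t = {t \<cdot> u | u. u \<in> traces A}"

definition dp :: "'a set \<Rightarrow> 'a set trace set \<Rightarrow> 'a set trace set" where
  "dp A X = {t \<in> traces A. extensions A t \<subseteq> prefixes_of A X}"

definition definitive_sets :: "'a set \<Rightarrow> 'a set trace set set" where
  "definitive_sets A = {X. X \<subseteq> traces A \<and> X = dp A X}"

text \<open>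
  \<open>Pr\<close> and \<open>Df\<close> are total HOL functions; they are meant to be applied only to definitive sets and
  to subsets of \<^term>\<open>inf_traces A\<close>, respectively.
\<close>

definition Pr :: "'a set \<Rightarrow> 'a set trace set \<Rightarrow> 'a set trace set" where
  "Pr A X = X \<inter> inf_traces A"

definition Df :: "'a set \<Rightarrow> 'a set trace set \<Rightarrow> 'a set trace set" where
  "Df A P = dp A P"

end

theory Submission
  imports Defs
begin

text \<open>
  An infinite trace is its own only extension, so a set and its set of definitive prefixes contain
  the same infinite traces. Since every trace extends to an infinite one, the infinite traces of a
  set already determine its definitive prefixes.
\<close>

lemma conc_assoc: "(t \<cdot> u) \<cdot> v = t \<cdot> u \<cdot> v"
  by (cases t; cases u; cases v) simp_all

lemma FinTr_in_traces_iff [simp]: "FinTr xs \<in> traces A \<longleftrightarrow> xs \<in> lists (states A)"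
  by (auto simp: traces_def fin_traces_def inf_traces_def)

lemma InfTr_in_inf_traces_iff [simp]: "InfTr s \<in> inf_traces A \<longleftrightarrow> s \<in> streams (states A)"
  by (auto simp: inf_traces_def)

lemma InfTr_in_traces_iff [simp]: "InfTr s \<in> traces A \<longleftrightarrow> s \<in> streams (states A)"
  by (auto simp: traces_def fin_traces_def)

lemma inf_traces_subset_traces: "inf_traces A \<subseteq> traces A"
  by (simp add: traces_def)

lemma conc_in_traces: "t \<in> traces A \<Longrightarrow> u \<in> traces A \<Longrightarrow> t \<cdot> u \<in> traces A"
  by (cases t; cases u) (auto intro: shift_streams)

lemma conc_inf_trace: "t \<in> inf_traces A \<Longrightarrow> t \<cdot> u = t"
  by (auto simp: inf_traces_def)

lemma ex_conc_in_inf_traces: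
  assumes "t \<in> traces A"
  obtains v where "v \<in> traces A" "t \<cdot> v \<in> inf_traces A"
proof
  \<comment> \<open>The empty set is a state for every \<open>A\<close>, even for
    \<open>A = {}\<close>, so this constant stream is always available. If \<open>t\<close> is
    already infinite, concatenation absorbs it.\<close>
  have s: "sconst {} \<in> streams (states A)"
    by (simp add: streams_iff_sset states_def)
  then show "InfTr (sconst {}) \<in> traces A"
    by simp
  from s assms show "t \<cdot> InfTr (sconst {}) \<in> inf_traces A"
    by (cases t) (auto intro: shift_streams)
qed

text \<open>An infinite trace absorbs any continuation, but being a prefix or an extension of itself
  still requires some continuation to exist; the empty trace serves.\<close>

lemma ex_trace: "\<exists>u. u \<in> traces A"
  using FinTr_in_traces_iff[of "[]"] by blast

lemma inf_trace_in_prefixes_of_iff: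
  assumes "t \<in> inf_traces A"
  shows "t \<in> prefixes_of A X \<longleftrightarrow> t \<in> X"
  using assms inf_traces_subset_traces[of A] ex_trace[of A]
  by (auto simp: prefixes_of_def conc_inf_trace)

lemma extensions_inf_trace: "t \<in> inf_traces A \<Longrightarrow> extensions A t = {t}"
  using ex_trace[of A] by (auto simp: extensions_def conc_inf_trace)

lemma inf_trace_in_dp_iff: "t \<in> inf_traces A \<Longrightarrow> t \<in> dp A X \<longleftrightarrow> t \<in> X"
  using inf_traces_subset_traces[of A]
  by (auto simp: dp_def extensions_inf_trace inf_trace_in_prefixes_of_iff)

lemma dp_mono: "X \<subseteq> Y \<Longrightarrow> dp A X \<subseteq> dp A Y"
  unfolding dp_def prefixes_of_def by blast

text \<open>This makes \<open>Df\<close> undo \<open>Pr\<close>: for definitive \<open>X\<close>, it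
  turns \<open>dp A (Pr A X)\<close> into \<open>dp A X\<close>, which is \<open>X\<close>.\<close>

lemma dp_Int_inf_traces: "dp A (X \<inter> inf_traces A) = dp A X"
proof
  show "dp A (X \<inter> inf_traces A) \<subseteq> dp A X"
    by (simp add: dp_mono)
  show "dp A X \<subseteq> dp A (X \<inter> inf_traces A)"
  proof
    fix t assume t: "t \<in> dp A X"
    have "t \<cdot> u \<in> prefixes_of A (X \<inter> inf_traces A)" if u: "u \<in> traces A" for u
    proof -
      have tu: "t \<cdot> u \<in> traces A"
        using t u by (simp add: dp_def conc_in_traces)
      then obtain v where v: "v \<in> traces A" and inf: "(t \<cdot> u) \<cdot> v \<in> inf_traces A"
        by (rule ex_conc_in_inf_traces)
      \<comment> \<open>By associativity the infinite trace extends \<open>t\<close> as well, so it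
        is a prefix of a member of \<open>X\<close>; being infinite, it equals that member. Thus
        \<open>t \<cdot> u\<close> is a prefix of an infinite trace in \<open>X\<close>.\<close>
      have "(t \<cdot> u) \<cdot> v \<in> extensions A t"
        using u v by (auto simp: extensions_def conc_assoc intro: conc_in_traces)
      then have "(t \<cdot> u) \<cdot> v \<in> X"
        using t inf by (auto simp: dp_def inf_trace_in_prefixes_of_iff)
      then show ?thesis
        using tu v inf by (auto simp: prefixes_of_def)
    qed
    then show "t \<in> dp A (X \<inter> inf_traces A)"
      using t by (auto simp: dp_def extensions_def)
  qed
qed

theorem theorem2:
  fixes A :: "'a set" and X P :: "'a set trace set"
  assumes "X \<in> definitive_sets A" and "P \<subseteq> inf_traces A"
  shows "Pr A X = P \<longleftrightarrow> X = Df A P"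
proof
  assume "Pr A X = P"
  then have "Df A P = dp A X"
    by (auto simp: Df_def Pr_def dp_Int_inf_traces)
  then show "X = Df A P"
    using assms(1) by (simp add: definitive_sets_def)
next
  assume "X = Df A P"
  then show "Pr A X = P"
    \<comment> \<open>The infinite traces in \<open>dp A P\<close> are those in \<open>P\<close>,
      and by assumption \<open>P\<close> has no others.\<close>
    using assms(2) by (auto simp: Pr_def Df_def inf_trace_in_dp_iff)
qed

end
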